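(* Let $F\colon\mathcal{C}\to\mathcal{D}$ be a functor between small categories. Then there exist a small category $E_F$ and functors $$\mathcal{C}\xrightarrow{F_1}E_F\xrightarrow{F_2}\mathcal{D},\qquad F=F_2\circ F_1,$$ such that $F_1$ is a right directed homotopy equivalence and $F_2$ is a Grothendieck opfibration.
   Context: All categories are small. For functors $F,G\colon\mathcal{C}\to\mathcal{D}$ write $F\leq_d G$ if there exists a natural transformation $F\Rightarrow G$. A functor $F_1\colon\mathcal{C}\to\mathcal{D}'$ is a right directed homotopy equivalence if there is a functor $R\colon\mathcal{D}'\to\mathcal{C}$ with $R F_1\leq_d 1_{\mathcal{C}}$ and $F_1 R\leq_d 1_{\mathcal{D}'}$. For a functor $P\colon\mathcal{E}\to\mathcal{B}$, a morphism $\varphi\colon e_1\to e_2$ in $\mathcal{E}$ is $P$-opcartesian if for every $\beta\colon e_1\to e$ in $\mathcal{E}$ and every $\overline\alpha\colon P(e_2)\to P(e)$ with $\overline\alpha\circ P(\varphi)=P(\beta)$, there is a unique $\alpha\colon e_2\to e$ with $\alpha\circ\varphi=\beta$ and $P(\alpha)=\overline\alpha$. $P$ is a Grothendieck opfibration if for every morphism $\overline\varphi\colon b_1\to b_2$ in $\mathcal{B}$ and every $e_1$ with $P(e_1)=b_1$ there is a $P$-opcartesian morphism $\varphi\colon e_1\to e_2$ with $P(\varphi)=\overline\varphi$. *)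

theory Defs
  imports Main
begin

text \<open>
  A category has a set of objects and a set of arrows inside HOL types, so every category here
  is small. Values of the operations outside the carriers are irrelevant.
  \<open>Comp C g f\<close> is the composite "g after f", meaningful if \<open>Cod C f = Dom C g\<close>.
\<close>

record ('o, 'a) cat =
  Obj  :: "'o set"
  Arr  :: "'a set"
  Dom  :: "'a \<Rightarrow> 'o"
  Cod  :: "'a \<Rightarrow> 'o"
  Id   :: "'o \<Rightarrow> 'a"
  Comp :: "'a \<Rightarrow> 'a \<Rightarrow> 'a"

definition Hom :: "('o, 'a) cat \<Rightarrow> 'o \<Rightarrow> 'o \<Rightarrow> 'a set" where
  "Hom C x y = {f \<in> Arr C. Dom C f = x \<and> Cod C f = y}"

locale category =
  fixes C :: "('o, 'a) cat"
  assumes Dom_in_Obj: "f \<in> Arr C \<Longrightarrow> Dom C f \<in> Obj C"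
    and Cod_in_Obj: "f \<in> Arr C \<Longrightarrow> Cod C f \<in> Obj C"
    and Id_in_Hom: "x \<in> Obj C \<Longrightarrow> Id C x \<in> Hom C x x"
    and Comp_in_Hom: "f \<in> Hom C x y \<Longrightarrow> g \<in> Hom C y z \<Longrightarrow> Comp C g f \<in> Hom C x z"
    and Comp_Id_left: "f \<in> Hom C x y \<Longrightarrow> Comp C (Id C y) f = f"
    and Comp_Id_right: "f \<in> Hom C x y \<Longrightarrow> Comp C f (Id C x) = f"
    and Comp_assoc: "f \<in> Hom C w x \<Longrightarrow> g \<in> Hom C x y \<Longrightarrow> h \<in> Hom C y z \<Longrightarrow>
      Comp C h (Comp C g f) = Comp C (Comp C h g) f"

record ('o1, 'a1, 'o2, 'a2) fctr =
  on_obj :: "'o1 \<Rightarrow> 'o2"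
  on_arr :: "'a1 \<Rightarrow> 'a2"

locale cat_functor = dom: category C + cod: category D
  for C :: "('o1, 'a1) cat" and D :: "('o2, 'a2) cat" +
  fixes F :: "('o1, 'a1, 'o2, 'a2) fctr"
  assumes on_obj_in_Obj: "x \<in> Obj C \<Longrightarrow> on_obj F x \<in> Obj D"
    and on_arr_in_Hom: "f \<in> Hom C x y \<Longrightarrow> on_arr F f \<in> Hom D (on_obj F x) (on_obj F y)"
    and on_arr_Id: "x \<in> Obj C \<Longrightarrow> on_arr F (Id C x) = Id D (on_obj F x)"
    and on_arr_Comp: "f \<in> Hom C x y \<Longrightarrow> g \<in> Hom C y z \<Longrightarrow>
      on_arr F (Comp C g f) = Comp D (on_arr F g) (on_arr F f)"

definition id_fctr :: "('o, 'a, 'o, 'a) fctr" where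
  "id_fctr = \<lparr>on_obj = (\<lambda>x. x), on_arr = (\<lambda>f. f)\<rparr>"

definition comp_fctr ::
  "('o2, 'a2, 'o3, 'a3) fctr \<Rightarrow> ('o1, 'a1, 'o2, 'a2) fctr \<Rightarrow> ('o1, 'a1, 'o3, 'a3) fctr" where
  "comp_fctr G F = \<lparr>on_obj = on_obj G \<circ> on_obj F, on_arr = on_arr G \<circ> on_arr F\<rparr>"

text \<open>
  Since the underlying maps are total on the ambient types, equality of functors with source
  \<open>C\<close> is agreement on the objects and arrows of \<open>C\<close>.
\<close>

definition fctr_eq ::
  "('o1, 'a1) cat \<Rightarrow> ('o1, 'a1, 'o2, 'a2) fctr \<Rightarrow> ('o1, 'a1, 'o2, 'a2) fctr \<Rightarrow> bool" where
  "fctr_eq C F G \<longleftrightarrow> (\<forall>x \<in> Obj C. on_obj F x = on_obj G x) \<and> (\<forall>f \<in> Arr C. on_arr F f = on_arr G f)"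

locale natural_transformation = source: cat_functor C D F + target: cat_functor C D G
  for C :: "('o1, 'a1) cat" and D :: "('o2, 'a2) cat" and F G +
  fixes \<eta> :: "'o1 \<Rightarrow> 'a2"
  assumes component_in_Hom: "x \<in> Obj C \<Longrightarrow> \<eta> x \<in> Hom D (on_obj F x) (on_obj G x)"
    and naturality: "f \<in> Hom C x y \<Longrightarrow>
      Comp D (\<eta> y) (on_arr F f) = Comp D (on_arr G f) (\<eta> x)"

definition directed_le ::
  "('o1, 'a1) cat \<Rightarrow> ('o2, 'a2) cat \<Rightarrow>
   ('o1, 'a1, 'o2, 'a2) fctr \<Rightarrow> ('o1, 'a1, 'o2, 'a2) fctr \<Rightarrow> bool" where
  "directed_le C D F G \<longleftrightarrow> (\<exists>\<eta>. natural_transformation C D F G \<eta>)"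

definition right_directed_homotopy_equivalence ::
  "('o1, 'a1) cat \<Rightarrow> ('o2, 'a2) cat \<Rightarrow> ('o1, 'a1, 'o2, 'a2) fctr \<Rightarrow> bool" where
  "right_directed_homotopy_equivalence C D F \<longleftrightarrow> cat_functor C D F \<and>
     (\<exists>R. cat_functor D C R \<and>
          directed_le C C (comp_fctr R F) id_fctr \<and>
          directed_le D D (comp_fctr F R) id_fctr)"

definition opcartesian ::
  "('o1, 'a1) cat \<Rightarrow> ('o2, 'a2) cat \<Rightarrow> ('o1, 'a1, 'o2, 'a2) fctr \<Rightarrow> 'a1 \<Rightarrow> bool" where
  "opcartesian E B P \<phi> \<longleftrightarrow> \<phi> \<in> Arr E \<and>
     (\<forall>e \<in> Obj E. \<forall>\<beta> \<in> Hom E (Dom E \<phi>) e.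
        \<forall>\<alpha>' \<in> Hom B (on_obj P (Cod E \<phi>)) (on_obj P e).
          Comp B \<alpha>' (on_arr P \<phi>) = on_arr P \<beta> \<longrightarrow>
          (\<exists>!\<alpha>. \<alpha> \<in> Hom E (Cod E \<phi>) e \<and> Comp E \<alpha> \<phi> = \<beta> \<and> on_arr P \<alpha> = \<alpha>'))"

definition grothendieck_opfibration ::
  "('o1, 'a1) cat \<Rightarrow> ('o2, 'a2) cat \<Rightarrow> ('o1, 'a1, 'o2, 'a2) fctr \<Rightarrow> bool" where
  "grothendieck_opfibration E B P \<longleftrightarrow> cat_functor E B P \<and>
     (\<forall>b1 \<in> Obj B. \<forall>b2 \<in> Obj B. \<forall>\<psi> \<in> Hom B b1 b2. \<forall>e1 \<in> Obj E. on_obj P e1 = b1 \<longrightarrow>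
        (\<exists>e2 \<in> Obj E. \<exists>\<phi> \<in> Hom E e1 e2. opcartesian E B P \<phi> \<and> on_arr P \<phi> = \<psi>))"

end

theory Submission
  imports Defs
begin

text \<open>
  Take for \<open>E\<^sub>F\<close> the comma category \<open>F \<down> D\<close>, with \<open>F\<^sub>1 c = (c, F c, 1)\<close> and \<open>F\<^sub>2\<close> the projection to
  \<open>D\<close>. The projection \<open>R\<close> to \<open>C\<close> satisfies \<open>R F\<^sub>1 = 1\<close>, and the structure arrow \<open>h\<close> of an
  object \<open>(c, d, h)\<close> yields the component \<open>(1, h) : (c, F c, 1) \<rightarrow> (c, d, h)\<close> of a transformation
  \<open>F\<^sub>1 R \<Rightarrow> 1\<close>. An opcartesian lift of \<open>\<psi> : d \<rightarrow> b\<close> at \<open>(c, d, h)\<close> is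
  \<open>(1, \<psi>) : (c, d, h) \<rightarrow> (c, b, \<psi> h)\<close>.
\<close>

type_synonym ('oc, 'od, 'ad) comma_obj = "'oc \<times> 'od \<times> 'ad"

type_synonym ('oc, 'ac, 'od, 'ad) comma_arr =
  "('oc, 'od, 'ad) comma_obj \<times> ('ac \<times> 'ad) \<times> ('oc, 'od, 'ad) comma_obj"

definition comma_Obj ::
  "('oc, 'ac) cat \<Rightarrow> ('od, 'ad) cat \<Rightarrow> ('oc, 'ac, 'od, 'ad) fctr \<Rightarrow>
   ('oc, 'od, 'ad) comma_obj set" where
  "comma_Obj C D F = {(c, d, h). c \<in> Obj C \<and> d \<in> Obj D \<and> h \<in> Hom D (on_obj F c) d}"

text \<open>The pair \<open>(f, g)\<close> fixes the endpoints in \<open>C\<close> and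
  \<open>D\<close> but not the structure arrows \<open>h\<close> and \<open>h'\<close>, so an arrow
  stores its source and target triples; \<open>Dom\<close> and \<open>Cod\<close> are then mere
  projections.\<close>

definition comma_Arr ::
  "('oc, 'ac) cat \<Rightarrow> ('od, 'ad) cat \<Rightarrow> ('oc, 'ac, 'od, 'ad) fctr \<Rightarrow>
   ('oc, 'ac, 'od, 'ad) comma_arr set" where
  "comma_Arr C D F = {((c, d, h), (f, g), (c', d', h')).
     (c, d, h) \<in> comma_Obj C D F \<and> (c', d', h') \<in> comma_Obj C D F \<and>
     f \<in> Hom C c c' \<and> g \<in> Hom D d d' \<and> Comp D g h = Comp D h' (on_arr F f)}"

definition comma_cat ::
  "('oc, 'ac) cat \<Rightarrow> ('od, 'ad) cat \<Rightarrow> ('oc, 'ac, 'od, 'ad) fctr \<Rightarrow>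
   (('oc, 'od, 'ad) comma_obj, ('oc, 'ac, 'od, 'ad) comma_arr) cat" where
  "comma_cat C D F = \<lparr>
     Obj = comma_Obj C D F,
     Arr = comma_Arr C D F,
     Dom = (\<lambda>(x, _, _). x),
     Cod = (\<lambda>(_, _, y). y),
     Id = (\<lambda>(c, d, h). ((c, d, h), (Id C c, Id D d), (c, d, h))),
     Comp = (\<lambda>(_, (f', g'), z) (x, (f, g), _). (x, (Comp C f' f, Comp D g' g), z))\<rparr>"

definition comma_unit ::
  "('oc, 'ac) cat \<Rightarrow> ('od, 'ad) cat \<Rightarrow> ('oc, 'ac, 'od, 'ad) fctr \<Rightarrow>
   ('oc, 'ac, ('oc, 'od, 'ad) comma_obj, ('oc, 'ac, 'od, 'ad) comma_arr) fctr" where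
  "comma_unit C D F =
     (let u = (\<lambda>c. (c, on_obj F c, Id D (on_obj F c)))
      in \<lparr>on_obj = u, on_arr = (\<lambda>f. (u (Dom C f), (f, on_arr F f), u (Cod C f)))\<rparr>)"

definition comma_fst ::
  "(('oc, 'od, 'ad) comma_obj, ('oc, 'ac, 'od, 'ad) comma_arr, 'oc, 'ac) fctr" where
  "comma_fst = \<lparr>on_obj = (\<lambda>(c, d, h). c), on_arr = (\<lambda>(x, (f, g), y). f)\<rparr>"

definition comma_snd ::
  "(('oc, 'od, 'ad) comma_obj, ('oc, 'ac, 'od, 'ad) comma_arr, 'od, 'ad) fctr" where
  "comma_snd = \<lparr>on_obj = (\<lambda>(c, d, h). d), on_arr = (\<lambda>(x, (f, g), y). g)\<rparr>"

section \<open>Computation rules on explicit tuples\<close>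

lemma Obj_comma_cat [simp]:
  "(c, d, h) \<in> Obj (comma_cat C D F) \<longleftrightarrow> c \<in> Obj C \<and> d \<in> Obj D \<and> h \<in> Hom D (on_obj F c) d"
  by (simp add: comma_cat_def comma_Obj_def)

lemma Hom_comma_cat [simp]:
  "(x, (f, g), y) \<in> Hom (comma_cat C D F) (c, d, h) (c', d', h') \<longleftrightarrow>
     x = (c, d, h) \<and> y = (c', d', h') \<and>
     (c, d, h) \<in> Obj (comma_cat C D F) \<and> (c', d', h') \<in> Obj (comma_cat C D F) \<and>
     f \<in> Hom C c c' \<and> g \<in> Hom D d d' \<and> Comp D g h = Comp D h' (on_arr F f)"
  \<comment> \<open>Only the hom-sets of the comma category are opened; those of \<open>C\<close>
    and \<open>D\<close> stay folded, which is the form in which the category and functor axioms use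
    them.\<close>
  unfolding Hom_def[of "comma_cat C D F"] by (auto simp: comma_cat_def comma_Arr_def)

lemma Dom_comma_cat [simp]: "Dom (comma_cat C D F) (x, p, y) = x"
  and Cod_comma_cat [simp]: "Cod (comma_cat C D F) (x, p, y) = y"
  and Id_comma_cat [simp]:
    "Id (comma_cat C D F) (c, d, h) = ((c, d, h), (Id C c, Id D d), (c, d, h))"
  and Comp_comma_cat [simp]:
    "Comp (comma_cat C D F) (y', (f', g'), z) (x, (f, g), y) = (x, (Comp C f' f, Comp D g' g), z)"
  by (simp_all add: comma_cat_def)

lemma comma_fst_simps [simp]:
  "on_obj comma_fst (c, d, h) = c" "on_arr comma_fst (x, (f, g), y) = f"
  by (simp_all add: comma_fst_def)

lemma comma_snd_simps [simp]:
  "on_obj comma_snd (c, d, h) = d" "on_arr comma_snd (x, (f, g), y) = g"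
  by (simp_all add: comma_snd_def)

lemma comma_unit_simps [simp]:
  "on_obj (comma_unit C D F) c = (c, on_obj F c, Id D (on_obj F c))"
  "on_arr (comma_unit C D F) f =
     ((Dom C f, on_obj F (Dom C f), Id D (on_obj F (Dom C f))), (f, on_arr F f),
      (Cod C f, on_obj F (Cod C f), Id D (on_obj F (Cod C f))))"
  by (simp_all add: comma_unit_def Let_def)

section \<open>General facts on categories and functors\<close>

lemma HomD: "f \<in> Hom C x y \<Longrightarrow> f \<in> Arr C \<and> Dom C f = x \<and> Cod C f = y"
  by (simp add: Hom_def)

lemma (in category) Hom_Obj: "f \<in> Hom C x y \<Longrightarrow> x \<in> Obj C \<and> y \<in> Obj C"
  using Dom_in_Obj Cod_in_Obj by (auto simp: Hom_def)

lemma (in category) cat_functor_id: "cat_functor C C id_fctr"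
  by unfold_locales (simp_all add: id_fctr_def)

lemma cat_functor_comp:
  assumes "cat_functor A B F" and "cat_functor B C G"
  shows "cat_functor A C (comp_fctr G F)"
proof -
  interpret F: cat_functor A B F by fact
  interpret G: cat_functor B C G by fact
  show ?thesis
  proof
    fix f g x y z assume "f \<in> Hom A x y" "g \<in> Hom A y z"
    then show "on_arr (comp_fctr G F) (Comp A g f) =
        Comp C (on_arr (comp_fctr G F) g) (on_arr (comp_fctr G F) f)"
      by (simp add: comp_fctr_def F.on_arr_Comp
          G.on_arr_Comp[OF F.on_arr_in_Hom F.on_arr_in_Hom])
  qed (simp_all add: comp_fctr_def F.on_obj_in_Obj G.on_obj_in_Obj F.on_arr_Id G.on_arr_Id
      F.on_arr_in_Hom G.on_arr_in_Hom)
qed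

context cat_functor
begin

text \<open>Commuting squares paste: \<open>g' g h = g' h' F(f) = h'' F(f') F(f)\<close>, and
  functoriality of \<open>F\<close> turns the last term into \<open>h'' F(f' f)\<close>.\<close>

lemma comma_Comp_in_Hom:
  assumes p: "p \<in> Hom (comma_cat C D F) x y" and q: "q \<in> Hom (comma_cat C D F) y z"
  shows "Comp (comma_cat C D F) q p \<in> Hom (comma_cat C D F) x z"
proof -
  obtain c d h c' d' h' c'' d'' h'' where
    xyz: "x = (c, d, h)" "y = (c', d', h')" "z = (c'', d'', h'')"
    by (metis prod_cases3)
  obtain f g f' g' where pq: "p = (x, (f, g), y)" "q = (y, (f', g'), z)"
    using p q unfolding xyz by (cases p; cases q) auto
  note P = p[unfolded pq xyz, simplified] and Q = q[unfolded pq xyz, simplified]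
  have Ff: "on_arr F f \<in> Hom D (on_obj F c) (on_obj F c')"
    and Ff': "on_arr F f' \<in> Hom D (on_obj F c') (on_obj F c'')"
    using P Q on_arr_in_Hom by blast+
  have "Comp D (Comp D g' g) h = Comp D g' (Comp D h' (on_arr F f))"
    using P Q by (metis cod.Comp_assoc)
  also have "\<dots> = Comp D (Comp D g' h') (on_arr F f)"
    using P Q cod.Comp_assoc[OF Ff] by blast
  also have "\<dots> = Comp D (Comp D h'' (on_arr F f')) (on_arr F f)"
    using Q by simp
  also have "\<dots> = Comp D h'' (on_arr F (Comp C f' f))"
    using P Q cod.Comp_assoc[OF Ff Ff', of h'' d''] on_arr_Comp[of f c c' f' c''] by simp
  finally show ?thesis
    unfolding pq xyz using P Q by (auto intro: dom.Comp_in_Hom cod.Comp_in_Hom)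
qed

text \<open>The unit and associativity laws hold in each coordinate separately. Only identities and
  composites have a square to check; for identities it reads \<open>1 h = h F(1)\<close>.\<close>

lemma category_comma: "category (comma_cat C D F)"
proof
  fix p assume "p \<in> Arr (comma_cat C D F)"
  then show "Dom (comma_cat C D F) p \<in> Obj (comma_cat C D F)"
    and "Cod (comma_cat C D F) p \<in> Obj (comma_cat C D F)"
    by (auto simp: comma_cat_def comma_Arr_def)
next
  fix x assume "x \<in> Obj (comma_cat C D F)"
  then show "Id (comma_cat C D F) x \<in> Hom (comma_cat C D F) x x"
    by (cases x) (auto simp: dom.Id_in_Hom cod.Id_in_Hom on_arr_Id cod.Comp_Id_left cod.Comp_Id_right)
next
  fix p x y assume "p \<in> Hom (comma_cat C D F) x y"
  then show "Comp (comma_cat C D F) (Id (comma_cat C D F) y) p = p"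
    and "Comp (comma_cat C D F) p (Id (comma_cat C D F) x) = p"
    by (cases p; cases x; cases y;
        auto simp: dom.Comp_Id_left cod.Comp_Id_left dom.Comp_Id_right cod.Comp_Id_right)+
next
  fix p q r w x y z
  assume "p \<in> Hom (comma_cat C D F) w x" "q \<in> Hom (comma_cat C D F) x y"
    "r \<in> Hom (comma_cat C D F) y z"
  then show "Comp (comma_cat C D F) r (Comp (comma_cat C D F) q p) =
      Comp (comma_cat C D F) (Comp (comma_cat C D F) r q) p"
    by (cases p; cases q; cases r; cases w; cases x; cases y; cases z;
        auto intro: dom.Comp_assoc cod.Comp_assoc)
qed (rule comma_Comp_in_Hom)

section \<open>The two projections and the functor from \<open>C\<close>\<close>

lemma cat_functor_comma_fst: "cat_functor (comma_cat C D F) C comma_fst"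
proof -
  interpret E: category "comma_cat C D F" by (rule category_comma)
  show ?thesis by unfold_locales auto
qed

lemma cat_functor_comma_snd: "cat_functor (comma_cat C D F) D comma_snd"
proof -
  interpret E: category "comma_cat C D F" by (rule category_comma)
  show ?thesis by unfold_locales auto
qed

text \<open>Both structure arrows in the square of \<open>(f, F f)\<close> are identities, so it
  commutes by the unit laws.\<close>

lemma cat_functor_comma_unit: "cat_functor C (comma_cat C D F) (comma_unit C D F)"
proof -
  interpret E: category "comma_cat C D F" by (rule category_comma)
  show ?thesis
  proof
    fix f x y assume f: "f \<in> Hom C x y"
    with on_arr_in_Hom have "on_arr F f \<in> Hom D (on_obj F x) (on_obj F y)" .
    with f show "on_arr (comma_unit C D F) f
        \<in> Hom (comma_cat C D F) (on_obj (comma_unit C D F) x) (on_obj (comma_unit C D F) y)"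
      using HomD[OF f] dom.Hom_Obj[OF f]
      by (simp add: on_obj_in_Obj cod.Id_in_Hom cod.Comp_Id_left cod.Comp_Id_right)
  next
    fix f g x y z assume f: "f \<in> Hom C x y" and g: "g \<in> Hom C y z"
    then show "on_arr (comma_unit C D F) (Comp C g f) =
        Comp (comma_cat C D F) (on_arr (comma_unit C D F) g) (on_arr (comma_unit C D F) f)"
      \<comment> \<open>\<open>comma_unit\<close> builds its end objects from \<open>Dom C\<close>
        and \<open>Cod C\<close> of the given arrow, so the endpoints of the composite have to be
        known as well.\<close>
      using HomD[OF f] HomD[OF g] HomD[OF dom.Comp_in_Hom[OF f g]] by (simp add: on_arr_Comp)
  next
    fix x assume x: "x \<in> Obj C"
    then show "on_arr (comma_unit C D F) (Id C x) =
        Id (comma_cat C D F) (on_obj (comma_unit C D F) x)"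
      using HomD[OF dom.Id_in_Hom[OF x]] by (simp add: on_arr_Id)
  qed (simp add: on_obj_in_Obj cod.Id_in_Hom)
qed

section \<open>The right directed homotopy equivalence\<close>

lemma directed_le_comma_fst_unit:
  "directed_le C C (comp_fctr comma_fst (comma_unit C D F)) id_fctr"
proof -
  \<comment> \<open>With both functors interpreted, only the components and naturality of the
    transformation remain to be checked.\<close>
  interpret S: cat_functor C C "comp_fctr comma_fst (comma_unit C D F)"
    by (rule cat_functor_comp[OF cat_functor_comma_unit cat_functor_comma_fst])
  interpret T: cat_functor C C id_fctr
    by (rule dom.cat_functor_id)
  have "natural_transformation C C (comp_fctr comma_fst (comma_unit C D F)) id_fctr (Id C)"
    by unfold_locales
      (simp_all add: comp_fctr_def id_fctr_def dom.Id_in_Hom dom.Comp_Id_left dom.Comp_Id_right)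
  then show ?thesis
    unfolding directed_le_def by blast
qed

text \<open>The component \<open>(1, h)\<close> is an arrow because \<open>F(1) = 1\<close> makes
  both sides of its square \<open>h 1\<close>.\<close>

lemma directed_le_comma_unit_fst:
  "directed_le (comma_cat C D F) (comma_cat C D F)
     (comp_fctr (comma_unit C D F) comma_fst) id_fctr"
proof -
  let ?E = "comma_cat C D F"
  let ?\<eta> = "\<lambda>(c, d, h). ((c, on_obj F c, Id D (on_obj F c)), (Id C c, h), (c, d, h))"
  interpret E: category ?E by (rule category_comma)
  interpret S: cat_functor ?E ?E "comp_fctr (comma_unit C D F) comma_fst"
    by (rule cat_functor_comp[OF cat_functor_comma_fst cat_functor_comma_unit])
  interpret T: cat_functor ?E ?E id_fctr
    by (rule E.cat_functor_id)
  have "natural_transformation ?E ?E (comp_fctr (comma_unit C D F) comma_fst) id_fctr ?\<eta>"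
  proof
    fix x assume "x \<in> Obj ?E"
    then show "?\<eta> x \<in> Hom ?E (on_obj (comp_fctr (comma_unit C D F) comma_fst) x) (on_obj id_fctr x)"
      by (cases x) (simp add: comp_fctr_def id_fctr_def on_obj_in_Obj dom.Id_in_Hom
          cod.Id_in_Hom on_arr_Id)
  next
    fix p x y assume "p \<in> Hom ?E x y"
    \<comment> \<open>For \<open>p\<close> with coordinates \<open>(f, g)\<close> the two sides are
      \<open>(1 f, h' F(f))\<close> and \<open>(f 1, g h)\<close>; the second coordinates agree
      precisely by the square that makes \<open>p\<close> an arrow.\<close>
    then show "Comp ?E (?\<eta> y) (on_arr (comp_fctr (comma_unit C D F) comma_fst) p) =
        Comp ?E (on_arr id_fctr p) (?\<eta> x)"
      by (cases x; cases y; cases p)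
        (auto simp: comp_fctr_def id_fctr_def dom.Comp_Id_left dom.Comp_Id_right dest: HomD[of _ C])
  qed
  then show ?thesis
    unfolding directed_le_def by blast
qed

section \<open>The opfibration\<close>

lemma opcartesian_comma_lift:
  assumes c: "c \<in> Obj C" and h: "h \<in> Hom D (on_obj F c) d" and \<psi>: "\<psi> \<in> Hom D d b"
  defines "\<phi> \<equiv> ((c, d, h), (Id C c, \<psi>), (c, b, Comp D \<psi> h))"
  shows "\<phi> \<in> Hom (comma_cat C D F) (c, d, h) (c, b, Comp D \<psi> h)"
    and "opcartesian (comma_cat C D F) D comma_snd \<phi>"
proof -
  let ?E = "comma_cat C D F"
  have \<psi>h: "Comp D \<psi> h \<in> Hom D (on_obj F c) b"
    using h \<psi> by (rule cod.Comp_in_Hom)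
  then show \<phi>: "\<phi> \<in> Hom ?E (c, d, h) (c, b, Comp D \<psi> h)"
    using c h \<psi> cod.Hom_Obj[OF \<psi>]
    by (simp add: \<phi>_def dom.Id_in_Hom on_arr_Id cod.Comp_Id_right)
  have "\<exists>!\<alpha>. \<alpha> \<in> Hom ?E (Cod ?E \<phi>) e \<and> Comp ?E \<alpha> \<phi> = \<beta> \<and> on_arr comma_snd \<alpha> = \<alpha>'"
    if e: "e \<in> Obj ?E" and \<beta>: "\<beta> \<in> Hom ?E (Dom ?E \<phi>) e"
      and \<alpha>': "\<alpha>' \<in> Hom D (on_obj comma_snd (Cod ?E \<phi>)) (on_obj comma_snd e)"
      and eq: "Comp D \<alpha>' (on_arr comma_snd \<phi>) = on_arr comma_snd \<beta>" for e \<beta> \<alpha>'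
  proof -
    obtain c' d' h' where e_eq: "e = (c', d', h')" by (cases e)
    obtain f g where \<beta>_eq: "\<beta> = ((c, d, h), (f, g), e)"
      using \<beta> unfolding \<phi>_def e_eq by (cases \<beta>) auto
    have f: "f \<in> Hom C c c'" and gh: "Comp D g h = Comp D h' (on_arr F f)"
      using \<beta> unfolding \<phi>_def e_eq \<beta>_eq by simp_all
    have \<alpha>'_Hom: "\<alpha>' \<in> Hom D b d'" and g_eq: "Comp D \<alpha>' \<psi> = g"
      using \<alpha>' eq unfolding \<phi>_def e_eq \<beta>_eq by simp_all
    \<comment> \<open>This is the square that makes \<open>(f, \<alpha>')\<close> an arrow out of
      \<open>(c, b, \<psi> h)\<close>; it follows from the square of \<beta> because
      \<open>g = \<alpha>' \<psi>\<close>.\<close>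
    have "Comp D \<alpha>' (Comp D \<psi> h) = Comp D h' (on_arr F f)"
      using cod.Comp_assoc[OF h \<psi> \<alpha>'_Hom] g_eq gh by simp
    \<comment> \<open>The factorization is forced: its second coordinate is its image \<alpha>'
      under \<open>comma_snd\<close>, and its first coordinate composed with \<open>1\<close> must
      be \<open>f\<close>.\<close>
    then show ?thesis
      using e c \<psi>h f \<alpha>'_Hom g_eq cod.Hom_Obj[OF \<psi>]
      by (intro ex1I[of _ "((c, b, Comp D \<psi> h), (f, \<alpha>'), e)"])
        (auto simp: \<phi>_def e_eq \<beta>_eq dom.Comp_Id_right)
  qed
  then show "opcartesian ?E D comma_snd \<phi>"
    using HomD[OF \<phi>] unfolding opcartesian_def by blast
qed

lemma grothendieck_opfibration_comma_snd:
  "grothendieck_opfibration (comma_cat C D F) D comma_snd"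
  unfolding grothendieck_opfibration_def
proof (intro conjI ballI impI cat_functor_comma_snd)
  fix b1 b2 \<psi> e1
  assume b2: "b2 \<in> Obj D" and \<psi>: "\<psi> \<in> Hom D b1 b2"
    and e1: "e1 \<in> Obj (comma_cat C D F)" "on_obj comma_snd e1 = b1"
  obtain c h where e1_eq: "e1 = (c, b1, h)"
    using e1(2) by (cases e1) auto
  have c: "c \<in> Obj C" and h: "h \<in> Hom D (on_obj F c) b1"
    using e1(1) by (simp_all add: e1_eq)
  show "\<exists>e2 \<in> Obj (comma_cat C D F). \<exists>\<phi> \<in> Hom (comma_cat C D F) e1 e2.
      opcartesian (comma_cat C D F) D comma_snd \<phi> \<and> on_arr comma_snd \<phi> = \<psi>"
    using opcartesian_comma_lift[OF c h \<psi>] c b2 cod.Comp_in_Hom[OF h \<psi>]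
    by (intro bexI[of _ "(c, b2, Comp D \<psi> h)"]
        bexI[of _ "((c, b1, h), (Id C c, \<psi>), (c, b2, Comp D \<psi> h))"]) (simp_all add: e1_eq)
qed

lemma right_directed_homotopy_equivalence_comma_unit:
  "right_directed_homotopy_equivalence C (comma_cat C D F) (comma_unit C D F)"
  unfolding right_directed_homotopy_equivalence_def
  using cat_functor_comma_unit cat_functor_comma_fst
    directed_le_comma_fst_unit directed_le_comma_unit_fst by blast

end

theorem proposition2p7:
  fixes C :: "('oc, 'ac) cat" and D :: "('od, 'ad) cat"
    and F :: "('oc, 'ac, 'od, 'ad) fctr"
  assumes "cat_functor C D F"
  shows "\<exists>(E :: ('oc \<times> 'od \<times> 'ad,
                 ('oc \<times> 'od \<times> 'ad) \<times> ('ac \<times> 'ad) \<times> ('oc \<times> 'od \<times> 'ad)) cat) F1 F2.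
           category E \<and> cat_functor C E F1 \<and> cat_functor E D F2 \<and>
           fctr_eq C F (comp_fctr F2 F1) \<and>
           right_directed_homotopy_equivalence C E F1 \<and>
           grothendieck_opfibration E D F2"
proof -
  interpret cat_functor C D F by fact
  \<comment> \<open>\<open>comma_unit\<close> carries \<open>F c\<close> and \<open>F f\<close> as
    second coordinates, which \<open>comma_snd\<close> reads off.\<close>
  have "fctr_eq C F (comp_fctr comma_snd (comma_unit C D F))"
    by (simp add: fctr_eq_def comp_fctr_def)
  then show ?thesis
    using category_comma cat_functor_comma_unit cat_functor_comma_snd
      right_directed_homotopy_equivalence_comma_unit grothendieck_opfibration_comma_snd
    by blast
qed

end
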